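(* Let $X\subseteq\mathbb{R}^m$, $f:X\to\mathbb{R}^d$ with $f^L\le f(x)\le f^U$ on $X$, $\phi:\mathbb{R}^d\to\mathbb{R}$, and let $(a,\mathcal{H})$ be a discretization scheme: $a\in\mathbb{R}^{d\times(n+1)}$ with $f_i^L=a_{i0}<\cdots<a_{in}=f_i^U$ for each $i$, integers $0=\tau(i,0)<\cdots<\tau(i,l_i)=n$, and $\mathcal{H}=\{\prod_{i=1}^d[a_{i\tau(i,t_i-1)},a_{i\tau(i,t_i)}]\mid t\in\prod_{i=1}^d\{1,\dots,l_i\}\}$. Let $u=(u_{ij}):\mathbb{R}^m\to\mathbb{R}^{d\times(n+1)}$ be a vector of convex functions such that for all $x\in X$, $i$, $j$: $u_{ij}(x)\le\min\{f_i(x),a_{ij}\}$, $u_{i0}(x)=a_{i0}$, $u_{in}(x)=f_i(x)$. Let $W$ be a convex outer-approximation of $\{(x,s_{\cdot n})\mid s_{\cdot n}=f(x),\ x\in X\}$. Then an MICP relaxation of the hypograph $\{(x,\mu)\mid x\in X,\ \mu\le\phi(f(x))\}$ of $\phi\circ f$ is given by the set of $(x,\mu,s,\delta)$ such that, for some $z$, $$\mu\le\mathrm{conc}_Q(\bar\phi)(s),\quad s=Z^{-1}(z),\quad u(x)\le s,\quad(x,s_{\cdot n})\in W,$$ $$z_i\in\Delta_i,\quad\delta_{it}\in\{0,1\},\quad z_{i\tau(i,t)}\ge\delta_{it}\ge z_{i\tau(i,t)+1}\quad(1\le i\le d,\ 1\le t\le l_i-1).$$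
   Context: $s=(s_1,\dots,s_d)$, $s_i=(s_{i0},\dots,s_{in})$, $s_{\cdot n}=(s_{1n},\dots,s_{dn})$, and $\bar\phi(s)=\phi(s_{1n},\dots,s_{dn})$. $\Delta_i=\{z_i\in\mathbb{R}^{n+1}\mid1=z_{i0}\ge z_{i1}\ge\cdots\ge z_{in}\ge0\}$. $Z^{-1}$ maps $z$ to $s$ with $s_{ij}=a_{i0}z_{i0}+\sum_{k=1}^j(a_{ik}-a_{i,k-1})z_{ik}$, $j=0,\dots,n$. $Q=\prod_{i=1}^dQ_i$, where $Q_i$ is the simplex with vertices $v_{ij}=(a_{i0},\dots,a_{i,j-1},a_{ij},\dots,a_{ij})\in\mathbb{R}^{n+1}$, $j=0,\dots,n$; $Z^{-1}$ maps $\prod_i\Delta_i$ onto $Q$. $\mathrm{conc}_Q(\bar\phi)$ is the concave envelope of $\bar\phi$ over $Q$. For $S\subseteq\mathbb{R}^{n_1}$, $E=R\cap(\mathbb{R}^{n_1}\times\mathbb{R}^{n_2}\times\{0,1\}^{n_3})$, with $R$ in the space of $(x,y,\delta)$, is an MIP relaxation of $S$ if $S\subseteq\mathrm{proj}_x(E)$; $R$ is its continuous relaxation (here $\delta_{it}\in\{0,1\}$ replaced by $\delta_{it}\in[0,1]$), and $E$ is an MICP relaxation if in addition $R$ is convex. *)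

theory Defs
  imports "HOL-Analysis.Analysis" "HOL-Analysis.Finite_Function_Topology"
begin

text \<open>
  A family \<open>(v\<^sub>i\<^sub>j)\<close> of reals, with \<open>i\<close> in a finite index type and \<open>j\<close> in a range of naturals that
  may depend on \<open>i\<close>, is an element of the real vector space below. The space of families indexed by
  \<open>{(i, j). j \<in> J i}\<close> is its subspace of vectors supported there. Pitfall: the library's order on
  \<open>poly_mapping\<close> is not componentwise, so componentwise inequalities are always spelled out.
\<close>

type_synonym 'i family = "(nat \<Rightarrow>\<^sub>0 real) ^ 'i"

abbreviation entry :: "'i::finite family \<Rightarrow> 'i \<Rightarrow> nat \<Rightarrow> real"
  where "entry v i j \<equiv> Poly_Mapping.lookup (v $ i) j"

definition family_space :: "('i::finite \<Rightarrow> nat set) \<Rightarrow> 'i family set"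
  where "family_space J = {v. \<forall>i. Poly_Mapping.keys (v $ i) \<subseteq> J i}"

definition binary_space :: "('i::finite \<Rightarrow> nat set) \<Rightarrow> 'i family set"
  where "binary_space J = {v \<in> family_space J. \<forall>i. \<forall>j\<in>J i. entry v i j \<in> {0, 1}}"

text \<open>The vector \<open>(g 0, \<dots>, g n)\<close> of \<open>\<real>\<^sup>n\<^sup>+\<^sup>1\<close>.\<close>

definition vec_upto :: "nat \<Rightarrow> (nat \<Rightarrow> real) \<Rightarrow> (nat \<Rightarrow>\<^sub>0 real)"
  where "vec_upto n g = (\<Sum>j\<le>n. Poly_Mapping.single j (g j))"

lemma lookup_vec_upto: "Poly_Mapping.lookup (vec_upto n g) j = (if j \<le> n then g j else 0)"
  by (simp add: vec_upto_def lookup_sum lookup_single when_def)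


section \<open>Concave envelopes\<close>

text \<open>
  The concave envelope is the least concave majorant. Since \<open>h\<close> need not have a finite concave
  majorant on \<open>Q\<close>, majorants are extended real valued, and concavity means convexity of the
  hypograph; for finite functions this is the library's \<open>concave_on\<close>, see below. As the majorants
  are unconstrained outside \<open>Q\<close> (assumed convex), the envelope is \<open>-\<infinity>\<close> there.
\<close>

definition hypograph :: "'a set \<Rightarrow> ('a \<Rightarrow> ereal) \<Rightarrow> ('a \<times> real) set"
  where "hypograph Q g = {(s, \<mu>). s \<in> Q \<and> ereal \<mu> \<le> g s}"

definition concave_envelope :: "'a::real_vector set \<Rightarrow> ('a \<Rightarrow> real) \<Rightarrow> 'a \<Rightarrow> ereal"
  where "concave_envelope Q h s =
    (INF g \<in> {g. convex (hypograph Q g) \<and> (\<forall>q\<in>Q. ereal (h q) \<le> g q)}. g s)"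

lemma convex_hypograph_real: "convex (hypograph Q (\<lambda>s. ereal (g s))) \<longleftrightarrow> concave_on Q g"
proof -
  define F where "F = (\<lambda>p :: 'a \<times> real. (fst p, - snd p))"
  have lin: "linear F"
    by (rule linearI) (auto simp: F_def)
  have FF: "F (F p) = p" for p
    by (simp add: F_def)
  have mem: "p \<in> hypograph Q (\<lambda>s. ereal (g s)) \<longleftrightarrow> F p \<in> epigraph Q (\<lambda>s. - g s)" for p
    by (auto simp: F_def hypograph_def epigraph_def split: prod.splits)
  have img: "F ` hypograph Q (\<lambda>s. ereal (g s)) = epigraph Q (\<lambda>s. - g s)" (is "F ` ?H = ?E")
  proof (intro subset_antisym subsetI)
    fix p assume "p \<in> ?E"
    then have "F p \<in> ?H"
      by (simp add: mem FF)
    then show "p \<in> F ` ?H"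
      using FF[of p] by (intro image_eqI[of _ _ "F p"]) auto
  qed (use mem in blast)
  have "F ` ?E = ?H"
    unfolding img[symmetric] image_image FF by simp
  then have "convex ?H \<longleftrightarrow> convex ?E"
    using convex_linear_image[OF lin, of ?H] convex_linear_image[OF lin, of ?E] img by auto
  then show ?thesis
    by (simp add: convex_epigraph concave_on_def)
qed


section \<open>Mixed-integer relaxations\<close>

text \<open>
  \<open>J\<close> and \<open>I\<close> are the index sets of the continuous and the binary auxiliary variables, \<open>E\<close> is the
  mixed-integer set and \<open>R\<close> its continuous relaxation.
\<close>

definition mip_relaxation ::
  "('j::finite \<Rightarrow> nat set) \<Rightarrow> ('i::finite \<Rightarrow> nat set) \<Rightarrow> 'x set \<Rightarrow>
   ('x \<times> 'j family \<times> 'i family) set \<Rightarrow> ('x \<times> 'j family \<times> 'i family) set \<Rightarrow> bool"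
  where "mip_relaxation J I S R E \<longleftrightarrow>
    R \<subseteq> UNIV \<times> family_space J \<times> family_space I \<and>
    E = R \<inter> (UNIV \<times> family_space J \<times> binary_space I) \<and>
    S \<subseteq> fst ` E"

definition micp_relaxation ::
  "('j::finite \<Rightarrow> nat set) \<Rightarrow> ('i::finite \<Rightarrow> nat set) \<Rightarrow> 'x::real_vector set \<Rightarrow>
   ('x \<times> 'j family \<times> 'i family) set \<Rightarrow> ('x \<times> 'j family \<times> 'i family) set \<Rightarrow> bool"
  where "micp_relaxation J I S R E \<longleftrightarrow> mip_relaxation J I S R E \<and> convex R"


section \<open>Discretization schemes\<close>

definition discretization_scheme ::
  "real^'d \<Rightarrow> real^'d \<Rightarrow> nat \<Rightarrow> ('d::finite \<Rightarrow> nat) \<Rightarrow> ('d \<Rightarrow> nat \<Rightarrow> nat) \<Rightarrow>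
   ('d \<Rightarrow> nat \<Rightarrow> real) \<Rightarrow> (real^'d) set set \<Rightarrow> bool"
  where "discretization_scheme fL fU n l \<tau> a H \<longleftrightarrow>
    (\<forall>i. a i 0 = fL $ i \<and> a i n = fU $ i \<and> strict_mono_on {..n} (a i)) \<and>
    (\<forall>i. \<tau> i 0 = 0 \<and> \<tau> i (l i) = n \<and> strict_mono_on {..l i} (\<tau> i)) \<and>
    H = {cbox (\<chi> i. a i (\<tau> i (t i - 1))) (\<chi> i. a i (\<tau> i (t i))) | t. \<forall>i. t i \<in> {1..l i}}"

definition Delta :: "nat \<Rightarrow> (nat \<Rightarrow>\<^sub>0 real) set"
  where "Delta n = {z. Poly_Mapping.keys z \<subseteq> {..n} \<and> Poly_Mapping.lookup z 0 = 1 \<and>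
    (\<forall>j<n. Poly_Mapping.lookup z (Suc j) \<le> Poly_Mapping.lookup z j) \<and>
    0 \<le> Poly_Mapping.lookup z n}"

definition Z_inv :: "nat \<Rightarrow> ('d::finite \<Rightarrow> nat \<Rightarrow> real) \<Rightarrow> 'd family \<Rightarrow> 'd family"
  where "Z_inv n a z = (\<chi> i. vec_upto n (\<lambda>j.
    a i 0 * entry z i 0 + (\<Sum>k=1..j. (a i k - a i (k - 1)) * entry z i k)))"

definition Q_vertex :: "nat \<Rightarrow> (nat \<Rightarrow> real) \<Rightarrow> nat \<Rightarrow> (nat \<Rightarrow>\<^sub>0 real)"
  where "Q_vertex n b j = vec_upto n (\<lambda>k. if k < j then b k else b j)"

definition Q_simplex :: "nat \<Rightarrow> (nat \<Rightarrow> real) \<Rightarrow> (nat \<Rightarrow>\<^sub>0 real) set"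
  where "Q_simplex n b = convex hull (Q_vertex n b ` {..n})"

definition Q_prod :: "nat \<Rightarrow> ('d::finite \<Rightarrow> nat \<Rightarrow> real) \<Rightarrow> 'd family set"
  where "Q_prod n a = {s. \<forall>i. s $ i \<in> Q_simplex n (a i)}"

definition last_col :: "nat \<Rightarrow> 'd::finite family \<Rightarrow> real^'d"
  where "last_col n s = (\<chi> i. entry s i n)"

definition phi_bar :: "nat \<Rightarrow> (real^'d \<Rightarrow> real) \<Rightarrow> 'd::finite family \<Rightarrow> real"
  where "phi_bar n \<phi> s = \<phi> (last_col n s)"

text \<open>
  The formulation with each \<open>\<delta>\<^sub>i\<^sub>t\<close> ranging over \<open>D\<close>: \<open>D = {0, 1}\<close> gives the mixed-integer set and
  \<open>D = {0..1}\<close> its continuous relaxation.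
\<close>

definition formulation ::
  "real set \<Rightarrow> nat \<Rightarrow> ('d::finite \<Rightarrow> nat) \<Rightarrow> ('d \<Rightarrow> nat \<Rightarrow> nat) \<Rightarrow> ('d \<Rightarrow> nat \<Rightarrow> real) \<Rightarrow>
   (real^'d \<Rightarrow> real) \<Rightarrow> ('d \<Rightarrow> nat \<Rightarrow> real^'m \<Rightarrow> real) \<Rightarrow> ((real^'m) \<times> (real^'d)) set \<Rightarrow>
   (((real^'m) \<times> real) \<times> 'd family \<times> 'd family) set"
  where "formulation D n l \<tau> a \<phi> u W = {((x, \<mu>), s, \<delta>).
    \<delta> \<in> family_space (\<lambda>i. {1..<l i}) \<and>
    (\<exists>z.
      ereal \<mu> \<le> concave_envelope (Q_prod n a) (phi_bar n \<phi>) s \<and>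
      s = Z_inv n a z \<and>
      (\<forall>i. \<forall>j\<le>n. u i j x \<le> entry s i j) \<and>
      (x, last_col n s) \<in> W \<and>
      (\<forall>i. z $ i \<in> Delta n) \<and>
      (\<forall>i. \<forall>t\<in>{1..<l i}. entry \<delta> i t \<in> D \<and>
        entry z i (\<tau> i t) \<ge> entry \<delta> i t \<and> entry \<delta> i t \<ge> entry z i (\<tau> i t + 1)))}"

end

theory Submission
  imports Defs
begin

text \<open>
  Given \<open>x \<in> X\<close>, choose \<open>s\<^sub>i\<^sub>j = min (f\<^sub>i x) a\<^sub>i\<^sub>j\<close>. Its preimage under \<open>Z\<^sup>-\<^sup>1\<close> fills the unit intervals
  in order: \<open>z\<^sub>i\<^sub>j\<close> is the fraction of \<open>[a\<^sub>i\<^sub>,\<^sub>j\<^sub>-\<^sub>1, a\<^sub>i\<^sub>j]\<close> lying below \<open>f\<^sub>i x\<close>, so at most one entry of each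
  row is fractional, and \<open>\<delta>\<^sub>i\<^sub>t = [f\<^sub>i x > a\<^sub>i\<^sub>,\<^sub>\<tau>\<^sub>(\<^sub>i\<^sub>,\<^sub>t\<^sub>)]\<close> is feasible. Since \<open>s \<in> Q\<close>, the envelope at \<open>s\<close> is
  at least \<open>\<phi> (f x)\<close>. The continuous relaxation is convex since each of its constraints is linear,
  convex, or membership in the hypograph of the envelope, an intersection of convex hypographs.
\<close>

lemma lookup_scaleR [simp]:
  fixes p :: "'a \<Rightarrow>\<^sub>0 'b::real_vector"
  shows "Poly_Mapping.lookup (c *\<^sub>R p) k = c *\<^sub>R Poly_Mapping.lookup p k"
proof -
  have "finite {k. c *\<^sub>R Poly_Mapping.lookup p k \<noteq> 0}"
    using finite_lookup[of p] by (rule finite_subset[rotated]) auto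
  then show ?thesis
    by (simp add: scaleR_poly_mapping_def lookup_Abs_poly_mapping)
qed

lemma keys_subset_iff_lookup:
  "Poly_Mapping.keys p \<subseteq> A \<longleftrightarrow> (\<forall>k. k \<notin> A \<longrightarrow> Poly_Mapping.lookup p k = 0)"
  by (auto simp: in_keys_iff)

lemma keys_vec_upto: "Poly_Mapping.keys (vec_upto n g) \<subseteq> {..n}"
  by (simp add: keys_subset_iff_lookup lookup_vec_upto)


section \<open>Concave envelopes\<close>

lemma concave_envelope_ge:
  assumes "q \<in> Q"
  shows "ereal (h q) \<le> concave_envelope Q h q"
  using assms by (auto simp: concave_envelope_def intro!: INF_greatest)

lemma concave_envelope_domain:
  assumes "convex Q" and "ereal \<mu> \<le> concave_envelope Q h s"
  shows "s \<in> Q"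
proof -
  \<comment> \<open>The coarsest majorant: its hypograph is the cylinder over \<open>Q\<close>,
    convex because \<open>Q\<close> is. Off \<open>Q\<close> it is minus infinity, which no real
    \<open>\<mu>\<close> can lie below.\<close>
  define g :: "'a \<Rightarrow> ereal" where "g = (\<lambda>q. if q \<in> Q then \<infinity> else - \<infinity>)"
  have "hypograph Q g = Q \<times> UNIV"
    by (auto simp: hypograph_def g_def)
  then have "convex (hypograph Q g)"
    using assms(1) by (simp add: convex_Times)
  then have "concave_envelope Q h s \<le> g s"
    unfolding concave_envelope_def by (intro INF_lower) (auto simp: g_def)
  then show ?thesis
    using assms(2) by (auto simp: g_def split: if_splits)
qed

lemma convex_hypograph_concave_envelope:
  assumes "convex Q"
  shows "convex (hypograph Q (concave_envelope Q h))"
proof -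
  define G where "G = {g. convex (hypograph Q g) \<and> (\<forall>q\<in>Q. ereal (h q) \<le> g q)}"
  \<comment> \<open>The hypograph of a pointwise infimum is the intersection of the hypographs. The
    factor \<open>Q \<times> UNIV\<close> makes the equation hold even for empty
    \<open>G\<close>.\<close>
  have "hypograph Q (concave_envelope Q h) = (Q \<times> UNIV) \<inter> (\<Inter>g\<in>G. hypograph Q g)"
    unfolding concave_envelope_def G_def[symmetric] by (auto simp: hypograph_def le_INF_iff)
  moreover have "convex (\<Inter>g\<in>G. hypograph Q g)"
    by (intro convex_INT) (simp add: G_def)
  ultimately show ?thesis
    using assms by (simp add: convex_Int convex_Times)
qed

text \<open>The formulation never states that \<open>s\<close> lies in \<open>Q_prod\<close>;
  \<open>concave_envelope_domain\<close> recovers this from the bound on a real number, so convexity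
  of the hypograph applies.\<close>

lemma concave_envelope_convex_combination:
  assumes Q: "convex Q" and "0 \<le> c" "0 \<le> d" "c + d = 1"
    and p: "ereal \<mu> \<le> concave_envelope Q h p" and q: "ereal \<nu> \<le> concave_envelope Q h q"
  shows "ereal (c * \<mu> + d * \<nu>) \<le> concave_envelope Q h (c *\<^sub>R p + d *\<^sub>R q)"
proof -
  have "(p, \<mu>) \<in> hypograph Q (concave_envelope Q h)"
    and "(q, \<nu>) \<in> hypograph Q (concave_envelope Q h)"
    using concave_envelope_domain[OF Q] p q by (auto simp: hypograph_def)
  then have "c *\<^sub>R (p, \<mu>) + d *\<^sub>R (q, \<nu>) \<in> hypograph Q (concave_envelope Q h)"
    using convex_hypograph_concave_envelope[OF Q] assms(2-4) by (intro convexD)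
  then show ?thesis
    by (simp add: hypograph_def)
qed


section \<open>The simplices\<close>

lemma convex_Q_prod: "convex (Q_prod n a)"
proof (rule convexI)
  fix p q and c d :: real
  assume *: "p \<in> Q_prod n a" "q \<in> Q_prod n a" and c: "0 \<le> c" "0 \<le> d" "c + d = 1"
  have "c *\<^sub>R p $ i + d *\<^sub>R q $ i \<in> Q_simplex n (a i)" for i
    unfolding Q_simplex_def
    by (rule convexD[OF convex_convex_hull]) (use * c in \<open>auto simp: Q_prod_def Q_simplex_def\<close>)
  then show "c *\<^sub>R p + d *\<^sub>R q \<in> Q_prod n a"
    by (simp add: Q_prod_def)
qed

lemma convex_Delta: "convex (Delta n)"
proof (rule convexI)
  fix p q :: "nat \<Rightarrow>\<^sub>0 real" and c d :: real
  assume "p \<in> Delta n" "q \<in> Delta n" "0 \<le> c" "0 \<le> d" "c + d = 1"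
  then show "c *\<^sub>R p + d *\<^sub>R q \<in> Delta n"
    by (auto simp: Delta_def keys_subset_iff_lookup lookup_add
        intro!: add_mono mult_left_mono)
qed

text \<open>Abel summation. It converts a sum weighted by the differences of \<open>z\<close> into
  the formula defining \<open>Z_inv\<close>; with constant \<open>b\<close> it shows that these
  weights sum to 1.\<close>

lemma summation_by_parts:
  fixes z b :: "nat \<Rightarrow> 'a::comm_ring"
  shows "(\<Sum>j\<le>n. (z j - z (Suc j)) * b j) =
    b 0 * z 0 + (\<Sum>k=1..n. (b k - b (k - 1)) * z k) - b n * z (Suc n)"
  by (induction n) (auto simp: algebra_simps)

text \<open>The form \<open>b (min j k)\<close> is constant in \<open>j\<close> once
  \<open>j\<close> reaches \<open>k\<close>, which later cuts the summation by parts off at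
  \<open>k\<close>.\<close>

lemma lookup_Q_vertex:
  "Poly_Mapping.lookup (Q_vertex n b j) k = (if k \<le> n then b (min j k) else 0)"
  by (auto simp: Q_vertex_def lookup_vec_upto min_def)

text \<open>Entries beyond \<open>n\<close> are zero by default, so the case \<open>j = n\<close> is
  the constraint that the last entry is nonnegative. This makes the last barycentric weight
  nonnegative too.\<close>

lemma lookup_Delta_decreasing:
  assumes "z \<in> Delta n"
  shows "Poly_Mapping.lookup z (Suc j) \<le> Poly_Mapping.lookup z j"
proof (cases "j < n")
  case False
  then have "j = n \<or> \<not> j \<le> n"
    by auto
  with assms have "Poly_Mapping.lookup z (Suc j) = 0" "j = n \<or> Poly_Mapping.lookup z j = 0"
    by (auto simp: Delta_def keys_subset_iff_lookup)
  with assms show ?thesis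
    by (auto simp: Delta_def)
qed (use assms in \<open>auto simp: Delta_def\<close>)

text \<open>The barycentric coordinates of the image point are the successive differences \<open>z\<^sub>j - z\<^sub>j\<^sub>+\<^sub>1\<close>.\<close>

lemma Z_inv_in_Q_prod:
  assumes "\<And>i. z $ i \<in> Delta n"
  shows "Z_inv n a z \<in> Q_prod n a"
proof -
  have "Z_inv n a z $ i \<in> Q_simplex n (a i)" for i
  proof -
    define w where "w j = entry z i j - entry z i (Suc j)" for j
    have z: "entry z i 0 = 1" "entry z i (Suc n) = 0"
      using assms[of i] by (auto simp: Delta_def keys_subset_iff_lookup)
    have "Z_inv n a z $ i = (\<Sum>j\<le>n. w j *\<^sub>R Q_vertex n (a i) j)"
    proof (rule poly_mapping_eqI)
      fix k
      show "entry (Z_inv n a z) i k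
        = Poly_Mapping.lookup (\<Sum>j\<le>n. w j *\<^sub>R Q_vertex n (a i) j) k"
      proof (cases "k \<le> n")
        case True
        have "(\<Sum>j\<le>n. w j * a i (min j k))
          = a i 0 + (\<Sum>j=1..n. (a i (min j k) - a i (min (j - 1) k)) * entry z i j)"
          using z summation_by_parts[of "entry z i" "\<lambda>j. a i (min j k)" n] by (simp add: w_def)
        also have "(\<Sum>j=1..n. (a i (min j k) - a i (min (j - 1) k)) * entry z i j)
          = (\<Sum>j=1..k. (a i j - a i (j - 1)) * entry z i j)"
          \<comment> \<open>For \<open>j > k\<close> both minima equal \<open>k\<close>, so the
            increment vanishes.\<close>
          using True by (intro sum.mono_neutral_cong_right)
            (auto simp: min_absorb1 min_absorb2)
        finally show ?thesis
          using True z by (simp add: Z_inv_def lookup_vec_upto lookup_sum lookup_Q_vertex)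
      qed (simp add: Z_inv_def lookup_vec_upto lookup_sum lookup_Q_vertex)
    qed
    also have "\<dots> \<in> convex hull (Q_vertex n (a i) ` {..n})"
    proof (intro convex_sum convex_convex_hull)
      show "(\<Sum>j\<le>n. w j) = 1"
        using summation_by_parts[of "entry z i" "\<lambda>_. 1" n] z by (simp add: w_def)
      show "0 \<le> w j" for j
        using lookup_Delta_decreasing[OF assms[of i]] by (simp add: w_def)
    qed (auto intro: hull_inc)
    finally show ?thesis
      by (simp add: Q_simplex_def)
  qed
  then show ?thesis
    by (simp add: Q_prod_def)
qed

lemma Z_inv_in_family_space: "Z_inv n a z \<in> family_space (\<lambda>i. {..n})"
  by (simp add: family_space_def Z_inv_def keys_vec_upto)

text \<open>The leading term carries the factor \<open>entry z i 0\<close>, so \<open>Z_inv\<close>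
  is linear in \<open>z\<close> and not merely affine.\<close>

lemma Z_inv_convex_combination:
  "Z_inv n a (c *\<^sub>R p + d *\<^sub>R q) = c *\<^sub>R Z_inv n a p + d *\<^sub>R Z_inv n a q"
  by (intro vec_eq_iff[THEN iffD2] allI poly_mapping_eqI)
    (simp add: Z_inv_def lookup_vec_upto lookup_add sum_distrib_left sum.distrib sum_subtractf algebra_simps)

lemma last_col_convex_combination:
  "last_col n (c *\<^sub>R p + d *\<^sub>R q) = c *\<^sub>R last_col n p + d *\<^sub>R last_col n q"
  by (simp add: last_col_def vec_eq_iff lookup_add)


section \<open>The relaxation\<close>

lemma formulation_mono:
  assumes "D \<subseteq> D'"
  shows "formulation D n l \<tau> a \<phi> u W \<subseteq> formulation D' n l \<tau> a \<phi> u W"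
  unfolding formulation_def using assms by blast

text \<open>\<open>D\<close> constrains only the entries of \<open>\<delta>\<close>, so the same
  \<open>z\<close> remains a witness.\<close>

lemma formulation_restrict:
  assumes "((x, \<mu>), s, \<delta>) \<in> formulation D n l \<tau> a \<phi> u W"
    and "\<forall>i. \<forall>t\<in>{1..<l i}. entry \<delta> i t \<in> D'"
  shows "((x, \<mu>), s, \<delta>) \<in> formulation D' n l \<tau> a \<phi> u W"
  using assms unfolding formulation_def mem_Collect_eq prod.case by blast

lemma convex_formulation:
  assumes "convex D" and "convex W" and "\<And>i j. j \<le> n \<Longrightarrow> convex_on UNIV (u i j)"
  shows "convex (formulation D n l \<tau> a \<phi> u W)"
proof (rule convexI)
  fix p p' and c c' :: real
  assume p: "p \<in> formulation D n l \<tau> a \<phi> u W" and p': "p' \<in> formulation D n l \<tau> a \<phi> u W"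
    and c: "0 \<le> c" "0 \<le> c'" "c + c' = 1"
  obtain x \<mu> s \<delta> where p_eq: "p = ((x, \<mu>), s, \<delta>)"
    by (metis surj_pair)
  obtain x' \<mu>' s' \<delta>' where p'_eq: "p' = ((x', \<mu>'), s', \<delta>')"
    by (metis surj_pair)
  let ?C = "concave_envelope (Q_prod n a) (phi_bar n \<phi>)"
  obtain z where z: "\<delta> \<in> family_space (\<lambda>i. {1..<l i})" "ereal \<mu> \<le> ?C s" "s = Z_inv n a z"
    "\<forall>i. \<forall>j\<le>n. u i j x \<le> entry s i j" "(x, last_col n s) \<in> W" "\<forall>i. z $ i \<in> Delta n"
    "\<forall>i. \<forall>t\<in>{1..<l i}. entry \<delta> i t \<in> D \<and>
        entry z i (\<tau> i t) \<ge> entry \<delta> i t \<and> entry \<delta> i t \<ge> entry z i (\<tau> i t + 1)"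
    using p unfolding p_eq formulation_def by blast
  obtain z' where z': "\<delta>' \<in> family_space (\<lambda>i. {1..<l i})" "ereal \<mu>' \<le> ?C s'" "s' = Z_inv n a z'"
    "\<forall>i. \<forall>j\<le>n. u i j x' \<le> entry s' i j" "(x', last_col n s') \<in> W" "\<forall>i. z' $ i \<in> Delta n"
    "\<forall>i. \<forall>t\<in>{1..<l i}. entry \<delta>' i t \<in> D \<and>
        entry z' i (\<tau> i t) \<ge> entry \<delta>' i t \<and> entry \<delta>' i t \<ge> entry z' i (\<tau> i t + 1)"
    using p' unfolding p'_eq formulation_def by blast
  \<comment> \<open>The projected-out \<open>z\<close> is combined with the same weights as the
    visible variables, which keeps \<open>s\<close> equal to the image of \<open>z\<close>.\<close>
  let ?x = "c *\<^sub>R x + c' *\<^sub>R x'" and ?s = "c *\<^sub>R s + c' *\<^sub>R s'" and ?z = "c *\<^sub>R z + c' *\<^sub>R z'"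
    and ?\<delta> = "c *\<^sub>R \<delta> + c' *\<^sub>R \<delta>'"
  have "?\<delta> \<in> family_space (\<lambda>i. {1..<l i})"
    using z(1) z'(1) by (simp add: family_space_def keys_subset_iff_lookup lookup_add)
  moreover have "ereal (c * \<mu> + c' * \<mu>') \<le> ?C ?s"
    using convex_Q_prod c z(2) z'(2) by (rule concave_envelope_convex_combination)
  moreover have "?s = Z_inv n a ?z"
    using z(3) z'(3) by (simp only: Z_inv_convex_combination)
  moreover have "u i j ?x \<le> entry ?s i j" if "j \<le> n" for i j
  proof -
    have "u i j ?x \<le> c * u i j x + c' * u i j x'"
      using assms(3)[OF that] c unfolding convex_on_def by auto
    also have "\<dots> \<le> c * entry s i j + c' * entry s' i j"
      using z(4) z'(4) c that by (intro add_mono mult_left_mono) auto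
    finally show ?thesis
      by (simp add: lookup_add)
  qed
  moreover have "(?x, last_col n ?s) \<in> W"
    using convexD[OF assms(2) z(5) z'(5) c] by (simp add: last_col_convex_combination)
  moreover have "?z $ i \<in> Delta n" for i
    using convexD[OF convex_Delta, of "z $ i" n "z' $ i" c c'] z(6) z'(6) c by simp
  moreover have "entry ?\<delta> i t \<in> D \<and>
      entry ?z i (\<tau> i t) \<ge> entry ?\<delta> i t \<and> entry ?\<delta> i t \<ge> entry ?z i (\<tau> i t + 1)"
    if "t \<in> {1..<l i}" for i t
    using z(7) z'(7) c that convexD[OF assms(1), of "entry \<delta> i t" "entry \<delta>' i t" c c']
    by (auto simp: lookup_add intro!: add_mono mult_left_mono)
  ultimately show "c *\<^sub>R p + c' *\<^sub>R p' \<in> formulation D n l \<tau> a \<phi> u W"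
    unfolding p_eq p'_eq formulation_def by (auto intro!: exI[of _ ?z])
qed

text \<open>Index 0 has no interval to its left: the quotient would have denominator zero, and
  \<open>Delta\<close> demands the value 1 there.\<close>

definition fill :: "(nat \<Rightarrow> real) \<Rightarrow> real \<Rightarrow> nat \<Rightarrow> real"
  where "fill b y j = (if j = 0 then 1 else max 0 (min 1 ((y - b (j - 1)) / (b j - b (j - 1)))))"

lemma fill_0 [simp]: "fill b y 0 = 1"
  by (simp add: fill_def)

lemma fill_bounds: "0 \<le> fill b y j" "fill b y j \<le> 1"
  by (auto simp: fill_def)

lemma fill_eq_1:
  assumes "strict_mono_on {..n} b" "j \<le> n" "b j \<le> y"
  shows "fill b y j = 1"
proof (cases j)
  case (Suc i)
  have "b i < b j"
    using assms(1) by (rule strict_mono_onD) (use Suc assms(2) in auto)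
  then show ?thesis
    using assms(3) Suc by (simp add: fill_def)
qed simp

text \<open>The interval after \<open>b j\<close> starts at or above \<open>y\<close>, so the
  quotient is nonpositive and is clamped to 0. Together with \<open>fill_eq_1\<close> this gives a
  dichotomy at each grid point: the interval before it is full or the one after it is empty.\<close>

lemma fill_Suc_eq_0:
  assumes "strict_mono_on {..n} b" "j < n" "y \<le> b j"
  shows "fill b y (Suc j) = 0"
proof -
  have "b j < b (Suc j)"
    using assms(1) by (rule strict_mono_onD) (use assms(2) in auto)
  then show ?thesis
    using assms(3) by (simp add: fill_def divide_le_0_iff)
qed

lemma vec_upto_fill_in_Delta:
  assumes "strict_mono_on {..n} b"
  shows "vec_upto n (fill b y) \<in> Delta n"
proof -
  have "fill b y (Suc j) \<le> fill b y j" if "j < n" for j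
  proof (cases "b j \<le> y")
    case True
    then show ?thesis
      using fill_eq_1[OF assms, of j y] fill_bounds that by simp
  next
    case False
    then show ?thesis
      using fill_Suc_eq_0[OF assms, of j y] fill_bounds that by simp
  qed
  then show ?thesis
    using keys_vec_upto fill_bounds by (simp add: Delta_def lookup_vec_upto)
qed

text \<open>Each term is the length of the part of its interval that lies below \<open>y\<close>,
  and these lengths add up to the part of the whole range up to \<open>b j\<close> below
  \<open>y\<close>.\<close>

lemma sum_fill:
  assumes "strict_mono_on {..n} b" "b 0 \<le> y" "j \<le> n"
  shows "b 0 + (\<Sum>k=1..j. (b k - b (k - 1)) * fill b y k) = min y (b j)"
  using assms(3)
proof (induction j)
  case (Suc j)
  have less: "b j < b (Suc j)"
    using assms(1) by (rule strict_mono_onD) (use Suc in auto)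
  have "min y (b j) + (b (Suc j) - b j) * fill b y (Suc j) = min y (b (Suc j))"
  proof (cases "y \<le> b j")
    case True
    then show ?thesis
      using fill_Suc_eq_0[OF assms(1), of j y] less Suc.prems by simp
  next
    case False
    \<comment> \<open>Here \<open>y\<close> exceeds \<open>b j\<close>, so the lower clamp is
      inactive.\<close>
    then have "fill b y (Suc j) = min 1 ((y - b j) / (b (Suc j) - b j))"
      using less by (simp add: fill_def)
    then show ?thesis
      using less False by (auto simp: min_def field_simps split: if_splits)
  qed
  then show ?case
    using Suc by simp
qed (use assms(2) in simp)

theorem theorem3p2:
  fixes X :: "(real^'m) set" and f :: "real^'m \<Rightarrow> real^'d" and fL fU :: "real^'d"
    and \<phi> :: "real^'d \<Rightarrow> real"
    and n :: nat and a :: "'d \<Rightarrow> nat \<Rightarrow> real" and l :: "'d \<Rightarrow> nat" and \<tau> :: "'d \<Rightarrow> nat \<Rightarrow> nat"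
    and H :: "(real^'d) set set"
    and u :: "'d \<Rightarrow> nat \<Rightarrow> real^'m \<Rightarrow> real" and W :: "((real^'m) \<times> (real^'d)) set"
  assumes "\<And>x i. x \<in> X \<Longrightarrow> fL $ i \<le> f x $ i \<and> f x $ i \<le> fU $ i"
    and "discretization_scheme fL fU n l \<tau> a H"
    and "\<And>i j. j \<le> n \<Longrightarrow> convex_on UNIV (u i j)"
    and "\<And>x i j. x \<in> X \<Longrightarrow> j \<le> n \<Longrightarrow> u i j x \<le> min (f x $ i) (a i j)"
    and "\<And>x i. x \<in> X \<Longrightarrow> u i 0 x = a i 0"
    and "\<And>x i. x \<in> X \<Longrightarrow> u i n x = f x $ i"
    and "convex W" and "{(x, y). x \<in> X \<and> y = f x} \<subseteq> W"
  shows "micp_relaxation (\<lambda>i. {..n}) (\<lambda>i. {1..<l i})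
    {(x, \<mu>). x \<in> X \<and> \<mu> \<le> \<phi> (f x)}
    (formulation {0..1} n l \<tau> a \<phi> u W)
    (formulation {0, 1} n l \<tau> a \<phi> u W)"
proof -
  let ?R = "formulation {0..1} n l \<tau> a \<phi> u W" and ?E = "formulation {0, 1} n l \<tau> a \<phi> u W"
  have a: "strict_mono_on {..n} (a i)" "a i 0 = fL $ i" "a i n = fU $ i"
    and \<tau>: "strict_mono_on {..l i} (\<tau> i)" "\<tau> i (l i) = n" for i
    using assms(2) by (auto simp: discretization_scheme_def)
  have "?R \<subseteq> UNIV \<times> family_space (\<lambda>i. {..n}) \<times> family_space (\<lambda>i. {1..<l i})"
    by (auto simp: formulation_def Z_inv_in_family_space)
  moreover have "?E = ?R \<inter> (UNIV \<times> family_space (\<lambda>i. {..n}) \<times> binary_space (\<lambda>i. {1..<l i}))"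
  proof (intro subset_antisym subsetI)
    fix p assume "p \<in> ?E"
    moreover from this have "p \<in> ?R"
      using formulation_mono[of "{0, 1}" "{0..1}" n l \<tau> a \<phi> u W] by auto
    ultimately show "p \<in> ?R \<inter> (UNIV \<times> family_space (\<lambda>i. {..n}) \<times> binary_space (\<lambda>i. {1..<l i}))"
      by (auto simp: formulation_def binary_space_def Z_inv_in_family_space)
  next
    fix p assume "p \<in> ?R \<inter> (UNIV \<times> family_space (\<lambda>i. {..n}) \<times> binary_space (\<lambda>i. {1..<l i}))"
    moreover obtain x \<mu> s \<delta> where "p = ((x, \<mu>), s, \<delta>)"
      by (metis surj_pair)
    ultimately show "p \<in> ?E"
      using formulation_restrict[of x \<mu> s \<delta> "{0..1}" n l \<tau> a \<phi> u W "{0, 1}"]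
      by (simp add: binary_space_def)
  qed
  moreover have "{(x, \<mu>). x \<in> X \<and> \<mu> \<le> \<phi> (f x)} \<subseteq> fst ` ?E"
  proof (clarify)
    fix x \<mu> assume x: "x \<in> X" and \<mu>: "\<mu> \<le> \<phi> (f x)"
    define z :: "'d family" where "z = (\<chi> i. vec_upto n (fill (a i) (f x $ i)))"
    \<comment> \<open>The index test inside the conditional zeroes the entries at 0 and
      \<open>l i\<close>, as membership in \<open>family_space\<close> requires.\<close>
    define \<delta> :: "'d family" where
      "\<delta> = (\<chi> i. vec_upto (l i) (\<lambda>t. if t \<in> {1..<l i} \<and> a i (\<tau> i t) < f x $ i then 1 else 0))"
    define s where "s = Z_inv n a z"
    have z_entry: "entry z i j = fill (a i) (f x $ i) j" if "j \<le> n" for i j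
      using that by (simp add: z_def lookup_vec_upto)
    have s_entry: "entry s i j = min (f x $ i) (a i j)" if "j \<le> n" for i j
    proof -
      have "entry s i j = a i 0 + (\<Sum>k=1..j. (a i k - a i (k - 1)) * fill (a i) (f x $ i) k)"
        using that by (simp add: s_def Z_inv_def lookup_vec_upto z_entry)
      then show ?thesis
        using sum_fill[OF a(1), of i "f x $ i" j] that assms(1)[OF x, of i] a(2) by simp
    qed
    \<comment> \<open>At \<open>j = n\<close> the minimum is attained by \<open>f x $ i\<close>,
      since \<open>a i n\<close> is its upper bound.\<close>
    have last: "last_col n s = f x"
      using assms(1)[OF x] a(3) by (simp add: last_col_def s_entry vec_eq_iff)
    have z_Delta: "z $ i \<in> Delta n" for i
      using vec_upto_fill_in_Delta[OF a(1)] by (simp add: z_def)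
    have "\<delta> \<in> family_space (\<lambda>i. {1..<l i})"
      by (auto simp: \<delta>_def family_space_def keys_subset_iff_lookup lookup_vec_upto)
    moreover have "ereal \<mu> \<le> concave_envelope (Q_prod n a) (phi_bar n \<phi>) s"
    proof -
      have "ereal \<mu> \<le> ereal (phi_bar n \<phi> s)"
        using \<mu> last by (simp add: phi_bar_def)
      also have "\<dots> \<le> concave_envelope (Q_prod n a) (phi_bar n \<phi>) s"
        unfolding s_def by (intro concave_envelope_ge Z_inv_in_Q_prod z_Delta)
      finally show ?thesis .
    qed
    \<comment> \<open>The entries of \<open>s\<close> are exactly the upper bounds assumed for
      \<open>u\<close>.\<close>
    moreover have "\<forall>i. \<forall>j\<le>n. u i j x \<le> entry s i j"
      using assms(4)[OF x] by (simp add: s_entry)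
    moreover have "(x, last_col n s) \<in> W"
      using assms(8) x last by auto
    moreover have "\<forall>i. \<forall>t\<in>{1..<l i}. entry \<delta> i t \<in> {0, 1} \<and>
        entry z i (\<tau> i t) \<ge> entry \<delta> i t \<and> entry \<delta> i t \<ge> entry z i (\<tau> i t + 1)"
    proof (intro allI ballI)
      fix i t assume t: "t \<in> {1..<l i}"
      \<comment> \<open>Strictness keeps the index \<open>\<tau> i t + 1\<close> within
        \<open>n\<close>. If \<open>f x $ i\<close> exceeds the breakpoint, \<open>\<delta>\<close>
        is 1 and the entry of \<open>z\<close> at \<open>\<tau> i t\<close> is full; otherwise
        \<open>\<delta>\<close> is 0 and the next entry is empty.\<close>
      have "\<tau> i t < \<tau> i (l i)"
        using \<tau>(1) by (rule strict_mono_onD) (use t in auto)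
      then have "\<tau> i t < n"
        using \<tau>(2) by simp
      then show "entry \<delta> i t \<in> {0, 1} \<and>
          entry z i (\<tau> i t) \<ge> entry \<delta> i t \<and> entry \<delta> i t \<ge> entry z i (\<tau> i t + 1)"
        using t fill_eq_1[OF a(1), of "\<tau> i t" i "f x $ i"]
          fill_Suc_eq_0[OF a(1), of "\<tau> i t" "f x $ i" i] fill_bounds
        by (cases "a i (\<tau> i t) < f x $ i") (simp_all add: \<delta>_def lookup_vec_upto z_entry)
    qed
    moreover have "\<forall>i. z $ i \<in> Delta n"
      using z_Delta by blast
    ultimately have "((x, \<mu>), s, \<delta>) \<in> ?E"
      unfolding formulation_def mem_Collect_eq prod.case using s_def by blast
    then show "(x, \<mu>) \<in> fst ` ?E"
      by (rule image_eqI[rotated]) simp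
  qed
  moreover have "convex ?R"
    using assms(3,7) by (intro convex_formulation) auto
  ultimately show ?thesis
    unfolding micp_relaxation_def mip_relaxation_def by (intro conjI)
qed

end
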